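(* Let $s \geq 3$ and $d \geq s$ be integers. Then for every $d$-dimensional convex polytope $P$ with exactly $d+s$ vertices and every $k$ with $1 \leq k \leq d-1$, \[ f_k(P) \geq \phi_k(d+s,d) := \binom{d+1}{k+1} + \binom{d}{k+1} - \binom{d+1-s}{k+1}. \]
   Context: For a polytope $P$, $f_k(P)$ denotes the number of $k$-dimensional faces of $P$. Binomial coefficients $\binom{n}{j}$ with $0 \le n < j$ are $0$. *)

theory Defs
  imports "HOL-Analysis.Analysis"
begin

definition face_number :: "nat \<Rightarrow> 'a::euclidean_space set \<Rightarrow> nat" where
  "face_number k P = card {F. F face_of P \<and> aff_dim F = int k}"

text \<open>The quantity \<open>\<phi>\<^sub>k(n, d)\<close>, written in terms of the number \<open>n = d + s\<close> of vertices. It is only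
  meant for \<open>d \<le> n \<le> 2 * d + 1\<close>, where neither of the two natural-number subtractions truncates; the
  outer subtraction is one of integers.\<close>

definition phi :: "nat \<Rightarrow> nat \<Rightarrow> nat \<Rightarrow> int" where
  "phi k n d = int ((d + 1) choose (k + 1)) + int (d choose (k + 1))
     - int ((d + 1 - (n - d)) choose (k + 1))"

end

theory Submission
  imports Defs
begin

text \<open>
  Induct on the dimension, for all \<open>1 \<le> s \<le> d\<close>. Unless \<open>P\<close> is a simplex, it has a facet \<open>F\<close>
  missing \<open>m \<ge> 2\<close> vertices. Ordering these as \<open>v\<^sub>1, \<dots>, v\<^sub>m\<close>, each \<open>v\<^sub>i\<close> lies in a face of
  dimension \<open>d - i + 1\<close> that avoids \<open>v\<^sub>1, \<dots>, v\<^bsub>i-1\<^esub>\<close>, because one can pass to a facet through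
  \<open>v\<^sub>i\<close> avoiding any prescribed further vertex. A vertex of a \<open>D\<close>-polytope lies in at least
  \<open>D choose k\<close> faces of dimension \<open>k\<close>, so at least \<open>\<Sum>i=1..m. (d - i + 1) choose k\<close> faces of
  dimension \<open>k\<close> are not in \<open>F\<close>. The induction hypothesis bounds the number of those in \<open>F\<close>, and
  convexity of \<open>n \<mapsto> n choose (k + 1)\<close> shows that the two bounds suffice.
\<close>

section \<open>Facets through a given face\<close>

text \<open>A nonempty proper face is the intersection of the facets containing it, so one of these
  facets must exclude \<open>x\<close>.\<close>

lemma facet_containing_face_avoiding_point:
  fixes P :: "'a::euclidean_space set"
  assumes "polytope P" "G face_of P" "G \<noteq> {}" "x \<in> P" "x \<notin> G"
  obtains F where "F facet_of P" "G \<subseteq> F" "x \<notin> F"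
proof -
  have "G = \<Inter>{F. F facet_of P \<and> G \<subseteq> F}"
    using assms by (intro face_of_polyhedron polytope_imp_polyhedron) auto
  with \<open>x \<notin> G\<close> that show ?thesis by blast
qed

lemma facet_of_subset_imp_eq:
  fixes P :: "'a::euclidean_space set"
  assumes "F facet_of P" "F' facet_of P" "F \<subseteq> F'"
  shows "F = F'"
proof (rule ccontr)
  assume "F \<noteq> F'"
  moreover have "F face_of F'"
    using assms face_of_face facet_of_imp_face_of by blast
  moreover have "convex F'"
    using assms(2) face_of_imp_convex facet_of_imp_face_of by blast
  ultimately have "aff_dim F < aff_dim F'"
    using face_of_aff_dim_lt by blast
  with assms show False by (simp add: facet_of_def)
qed

section \<open>Counting the faces above a given face\<close>

text \<open>Descend through facets that contain \<open>G\<close> but do not lie in \<open>F\<close>,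
  replacing \<open>F\<close> by its trace on each facet. Once \<open>G\<close> has codimension one,
  the current polytope itself serves as \<open>H\<close>.\<close>

lemma cover_face_not_subset_face:
  fixes P :: "'a::euclidean_space set"
  assumes "polytope P" "G face_of P" "G \<noteq> {}" "aff_dim P = aff_dim G + 1 + int n"
    and "F face_of P" "F \<noteq> P" "G \<subseteq> F"
  shows "\<exists>H. H face_of P \<and> G \<subseteq> H \<and> \<not> H \<subseteq> F \<and> aff_dim H = aff_dim G + 1"
  using assms
proof (induction n arbitrary: P F)
  case 0
  then have "P face_of P"
    by (simp add: face_of_refl polytope_imp_convex)
  with 0 show ?case
    using face_of_imp_subset by (intro exI[of _ P]) auto
next
  case (Suc n)
  have "polyhedron P" using Suc.prems(1) by (rule polytope_imp_polyhedron)
  then obtain F1 where F1: "F1 facet_of P" "F \<subseteq> F1"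
    using face_of_polyhedron_subset_facet[of P F] Suc.prems by blast
  \<comment> \<open>Here \<open>G\<close> has codimension at least 2. A point of \<open>F1\<close>
    outside \<open>G\<close> then yields a second facet through \<open>G\<close>, and distinct
    facets are never nested.\<close>
  then have "G \<noteq> F1" using Suc.prems(4) by (auto simp: facet_of_def)
  then obtain x where x: "x \<in> F1" "x \<notin> G" using Suc.prems F1 by blast
  then have "x \<in> P" using F1 facet_of_imp_subset by blast
  then obtain F' where F': "F' facet_of P" "G \<subseteq> F'" "x \<notin> F'"
    using facet_containing_face_avoiding_point[of P G x] Suc.prems x by blast
  have "\<not> F' \<subseteq> F1" using facet_of_subset_imp_eq F' F1 x by blast
  then have "\<not> F' \<subseteq> F" using F1 by blast
  have face: "F' face_of P" using F' facet_of_imp_face_of by blast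
  have "\<exists>H. H face_of F' \<and> G \<subseteq> H \<and> \<not> H \<subseteq> F \<inter> F' \<and> aff_dim H = aff_dim G + 1"
  proof (rule Suc.IH)
    show "polytope F'" using Suc.prems(1) face by (rule face_of_polytope_polytope)
    show "G face_of F'" using F' Suc.prems face face_of_face by blast
    show "F \<inter> F' face_of F'"
      using Suc.prems(5) face face_of_Int face_of_face by blast
    show "aff_dim F' = aff_dim G + 1 + int n"
      using F' Suc.prems(4) by (simp add: facet_of_def)
  qed (use Suc.prems F' \<open>\<not> F' \<subseteq> F\<close> in auto)
  then show ?case
    using face face_of_trans face_of_imp_subset by (metis le_inf_iff)
qed

text \<open>This is Pascal's rule: some of the faces above \<open>G\<close> lie in a facet
  \<open>F\<close> through \<open>G\<close>, others contain a face \<open>K\<close> that covers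
  \<open>G\<close> and is not inside \<open>F\<close>. No face is of both kinds. For a vertex
  \<open>G\<close> the bound counts the \<open>j\<close>-faces through it.\<close>

lemma card_faces_containing_face_ge:
  fixes P :: "'a::euclidean_space set"
  assumes "polytope P" "G face_of P" "G \<noteq> {}" "aff_dim P = aff_dim G + int n"
  shows "n choose j \<le> card {H. H face_of P \<and> G \<subseteq> H \<and> aff_dim H = aff_dim G + int j}"
  using assms
proof (induction n arbitrary: P G j)
  case 0
  then have "G = P"
    using face_of_aff_dim_lt[of P G] polytope_imp_convex by fastforce
  then have "{H. H face_of P \<and> G \<subseteq> H \<and> aff_dim H = aff_dim G + int 0} = {P}"
    using 0 face_of_imp_subset by (auto simp: face_of_refl polytope_imp_convex)
  then show ?case by (cases j) auto
next
  case (Suc n)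
  let ?T = "\<lambda>P G j. {H. H face_of P \<and> G \<subseteq> H \<and> aff_dim H = aff_dim G + int j}"
  have fin: "finite (?T P G j)" for G j
    by (rule finite_subset[OF _ finite_polytope_faces[OF Suc.prems(1)]]) auto
  show ?case
  proof (cases j)
    case 0
    have "G \<in> ?T P G j" using Suc.prems 0 by simp
    then have "card (?T P G j) > 0" using fin card_gt_0_iff by blast
    with 0 show ?thesis by simp
  next
    case (Suc i)
    have "polyhedron P" using Suc.prems(1) by (rule polytope_imp_polyhedron)
    moreover have "G \<noteq> P" using Suc.prems by auto
    ultimately obtain F where F: "F facet_of P" "G \<subseteq> F"
      using face_of_polyhedron_subset_facet[of P G] Suc.prems by blast
    then have face: "F face_of P" "F \<noteq> P" by (auto simp: facet_of_def)
    obtain K where K: "K face_of P" "G \<subseteq> K" "\<not> K \<subseteq> F" "aff_dim K = aff_dim G + 1"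
      using cover_face_not_subset_face[of P G n F] Suc.prems face F by auto
    have "n choose j \<le> card (?T F G j)"
    proof (rule Suc.IH)
      show "polytope F" using Suc.prems(1) face(1) by (rule face_of_polytope_polytope)
      show "G face_of F" using F Suc.prems face face_of_face by blast
    qed (use Suc.prems F in \<open>auto simp: facet_of_def\<close>)
    moreover have "n choose i \<le> card (?T P K i)"
      by (rule Suc.IH) (use Suc.prems K in auto)
    moreover have "card (?T F G j) + card (?T P K i) = card (?T F G j \<union> ?T P K i)"
    proof (rule card_Un_disjoint[symmetric])
      show "finite (?T F G j)"
        by (rule finite_subset[OF _ fin[of G j]]) (use face face_of_trans in auto)
      show "?T F G j \<inter> ?T P K i = {}" using K face_of_imp_subset by blast
    qed (rule fin)
    moreover have "\<dots> \<le> card (?T P G j)"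
      using K face Suc by (intro card_mono fin) (auto intro: face_of_trans)
    ultimately show ?thesis using Suc by simp
  qed
qed

section \<open>Counting the faces that meet a set of vertices\<close>

text \<open>Each point of \<open>S\<close> costs one dimension: pass to a facet through
  \<open>v\<close> that misses it. A point already outside the polytope is missed by every facet,
  and one still descends to keep the dimension exact.\<close>

lemma face_containing_vertex_avoiding_set:
  fixes P :: "'a::euclidean_space set"
  assumes "finite S" "polytope P" "v extreme_point_of P" "v \<notin> S"
    and "aff_dim P = int (card S) + int n"
  shows "\<exists>F. F face_of P \<and> v \<in> F \<and> F \<inter> S = {} \<and> aff_dim F = int n"
  using assms
proof (induction S arbitrary: P rule: finite_induct)
  case empty
  then show ?case
    by (intro exI[of _ P]) (auto simp: face_of_refl polytope_imp_convex extreme_point_of_def)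
next
  case (insert u S)
  have v: "{v} face_of P" using insert.prems by (simp add: face_of_singleton)
  obtain F where F: "F facet_of P" "v \<in> F" "u \<notin> F"
  proof (cases "u \<in> P")
    case True
    then show ?thesis
      using facet_containing_face_avoiding_point[of P "{v}" u] v insert.prems that by auto
  next
    case False
    have "polyhedron P" using insert.prems(1) by (rule polytope_imp_polyhedron)
    moreover have "aff_dim P \<noteq> 0" using insert by simp
    then have "{v} \<noteq> P" by auto
    ultimately obtain F where "F facet_of P" "{v} \<subseteq> F"
      using face_of_polyhedron_subset_facet[of P "{v}"] v by blast
    then show ?thesis using that False facet_of_imp_subset by blast
  qed
  have face: "F face_of P" using F facet_of_imp_face_of by blast
  have "\<exists>F'. F' face_of F \<and> v \<in> F' \<and> F' \<inter> S = {} \<and> aff_dim F' = int n"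
  proof (rule insert.IH)
    show "polytope F" using insert.prems(1) face by (rule face_of_polytope_polytope)
    show "v extreme_point_of F" using face F insert.prems extreme_point_of_face by blast
    show "aff_dim F = int (card S) + int n" using F insert by (simp add: facet_of_def)
  qed (use insert.prems in auto)
  then show ?case
    using face F face_of_trans face_of_imp_subset by (metis Int_insert_right subsetD)
qed

text \<open>A new vertex \<open>v\<close> lies in a face of dimension \<open>d - card S\<close> that
  avoids the earlier vertices \<open>S\<close>. The \<open>k\<close>-faces of that face through
  \<open>v\<close> miss \<open>S\<close>, so none of them has been counted before.\<close>

lemma card_faces_meeting_vertices_ge:
  fixes P :: "'a::euclidean_space set"
  assumes "finite S" "polytope P" "\<And>v. v \<in> S \<Longrightarrow> v extreme_point_of P"
    and "aff_dim P = int d" "card S \<le> d"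
  shows "(\<Sum>i<card S. (d - i) choose k)
    \<le> card {H. H face_of P \<and> H \<inter> S \<noteq> {} \<and> aff_dim H = int k}"
  using assms
proof (induction S rule: finite_induct)
  case empty
  then show ?case by simp
next
  case (insert v S)
  let ?A = "\<lambda>S. {H. H face_of P \<and> H \<inter> S \<noteq> {} \<and> aff_dim H = int k}"
  have fin: "finite {H. H face_of P}" using insert.prems(1) by (rule finite_polytope_faces)
  have finA: "finite (?A S)" for S by (rule finite_subset[OF _ fin]) auto
  have "v extreme_point_of P" using insert.prems by blast
  moreover have "aff_dim P = int (card S) + int (d - card S)"
    using insert by simp
  ultimately obtain F where F: "F face_of P" "v \<in> F" "F \<inter> S = {}" "aff_dim F = int (d - card S)"
    using face_containing_vertex_avoiding_set[of S P v "d - card S"] insert by blast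
  let ?B = "{H. H face_of F \<and> {v} \<subseteq> H \<and> aff_dim H = aff_dim {v} + int k}"
  have "polytope F" using insert.prems(1) F(1) by (rule face_of_polytope_polytope)
  moreover have "{v} face_of F"
    using F \<open>v extreme_point_of P\<close> extreme_point_of_face face_of_singleton by blast
  ultimately have B: "(d - card S) choose k \<le> card ?B"
    using F by (intro card_faces_containing_face_ge) auto
  have IH: "(\<Sum>i<card S. (d - i) choose k) \<le> card (?A S)"
    using insert by simp
  have "card (?A S) + card ?B = card (?A S \<union> ?B)"
  proof (rule card_Un_disjoint[symmetric])
    show "finite ?B" by (rule finite_subset[OF _ fin]) (use F face_of_trans in auto)
    show "?A S \<inter> ?B = {}" using F face_of_imp_subset by blast
  qed (rule finA)
  also have "\<dots> \<le> card (?A (insert v S))"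
    using F by (intro card_mono finA) (auto intro: face_of_trans)
  finally show ?case using B IH insert.hyps by simp
qed

section \<open>Vertices missed by a facet\<close>

text \<open>If every facet missed at most one vertex, a facet avoiding \<open>v\<close> would
  contain all other vertices, and its hyperplane would separate \<open>v\<close> from their affine
  hull. The vertices would be affinely independent, leaving only \<open>d + 1\<close> of
  them.\<close>

lemma facet_missing_two_vertices:
  fixes P :: "'a::euclidean_space set"
  assumes "polytope P" "aff_dim P = int d" "card {v. v extreme_point_of P} > d + 1"
  obtains F where "F facet_of P" "2 \<le> card ({v. v extreme_point_of P} - F)"
proof (rule ccontr)
  let ?V = "{v. v extreme_point_of P}"
  assume "\<not> thesis"
  with that have less: "card (?V - F) < 2" if "F facet_of P" for F
    using that not_le by blast
  have fin: "finite ?V"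
    using assms(1) finite_polyhedron_extreme_points polytope_imp_polyhedron by blast
  have "v \<notin> affine hull (?V - {v})" if v: "v \<in> ?V" for v
  proof -
    \<comment> \<open>A second vertex \<open>w\<close> supplies the nonempty face from which a facet
      avoiding \<open>v\<close> is obtained.\<close>
    have "card (?V - {v}) > 0" using assms(3) v fin by simp
    then obtain w where w: "w \<in> ?V" "w \<noteq> v" by (auto simp: card_gt_0_iff)
    moreover have "v \<in> P" using v by (simp add: extreme_point_of_def)
    ultimately obtain F where F: "F facet_of P" "{w} \<subseteq> F" "v \<notin> F"
      using facet_containing_face_avoiding_point[of P "{w}" v] assms(1)
      by (auto simp: face_of_singleton)
    have "card (?V - F) \<le> Suc 0" using less[OF F(1)] by simp
    then have "?V - {v} \<subseteq> F"
      using v F fin by (auto simp: card_le_Suc0_iff_eq)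
    moreover obtain a b where ab: "F = P \<inter> {x. a \<bullet> x = b}"
      using facet_of_polyhedron[of P F] F assms(1) polytope_imp_polyhedron by blast
    ultimately have "affine hull (?V - {v}) \<subseteq> {x. a \<bullet> x = b}"
      by (intro hull_minimal affine_hyperplane) auto
    then show ?thesis using ab F \<open>v \<in> P\<close> by blast
  qed
  then have "\<not> affine_dependent ?V" by (auto simp: affine_dependent_def)
  then have "aff_dim ?V = int (card ?V) - 1"
    by (simp add: aff_dim_affine_independent)
  moreover have "P = convex hull ?V"
    using assms(1) by (intro Krein_Milman_Minkowski polytope_imp_compact polytope_imp_convex)
  then have "aff_dim P = aff_dim ?V" by (metis aff_dim_convex_hull)
  ultimately show False using assms by simp
qed

lemma card_vertices_polytope_gt_aff_dim:
  fixes P :: "'a::euclidean_space set"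
  assumes "polytope P"
  shows "aff_dim P < int (card {v. v extreme_point_of P})"
proof -
  let ?V = "{v. v extreme_point_of P}"
  have "finite ?V"
    using assms finite_polyhedron_extreme_points polytope_imp_polyhedron by blast
  moreover have "P = convex hull ?V"
    using assms by (intro Krein_Milman_Minkowski polytope_imp_compact polytope_imp_convex)
  then have "aff_dim P = aff_dim ?V" by (metis aff_dim_convex_hull)
  ultimately show ?thesis using aff_dim_le_card[of ?V] by simp
qed

section \<open>Binomial coefficients\<close>

lemma sum_choose_descending:
  fixes d m k :: nat
  assumes "m \<le> d + 1"
  shows "(\<Sum>i<m. (d - i) choose k) + ((d + 1 - m) choose (k + 1)) = (d + 1) choose (k + 1)"
  using assms
proof (induction m)
  case (Suc m)
  then have "d + 1 - m = Suc (d - m)" by simp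
  with Suc show ?case by simp
qed simp

text \<open>By Pascal's rule, raising \<open>x\<close> by one increases the two sides by binomial
  coefficients with the same lower index \<open>j\<close>, and the right-hand one has the larger
  upper index.\<close>

lemma choose_convex:
  fixes b x y k :: nat
  shows "((b + x) choose k) + ((b + y) choose k) \<le> ((b + x + y) choose k) + (b choose k)"
proof (cases k)
  case (Suc j)
  show ?thesis
  proof (induction x)
    case (Suc x)
    have "(b + x) choose j \<le> (b + x + y) choose j" by (rule binomial_right_mono) simp
    with Suc show ?case by (simp add: \<open>k = Suc j\<close>)
  qed simp
qed simp

section \<open>The induction on the dimension\<close>

text \<open>The ranges \<open>1 \<le> s\<close> and \<open>k \<le> d\<close> make the claim
  hereditary: a facet may be a simplex, and it may itself have dimension \<open>k\<close>. The
  subtracted binomial stands on the right to keep the inequality in the naturals.\<close>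

lemma face_number_lower_bound:
  fixes P :: "'a::euclidean_space set"
  assumes "polytope P" "aff_dim P = int d" "card {v. v extreme_point_of P} = d + s"
    and "1 \<le> s" "s \<le> d" "1 \<le> k" "k \<le> d"
  shows "((d + 1) choose (k + 1)) + (d choose (k + 1))
    \<le> face_number k P + ((d + 1 - s) choose (k + 1))"
  using assms
proof (induction d arbitrary: P s)
  case 0
  then show ?case by simp
next
  case (Suc d)
  let ?V = "{v. v extreme_point_of P}"
  let ?A = "\<lambda>P. {F. F face_of P \<and> aff_dim F = int k}"
  have finA: "finite (?A P)"
    by (rule finite_subset[OF _ finite_polytope_faces[OF Suc.prems(1)]]) auto
  show ?case
  proof (cases "k = Suc d")
    case True
    \<comment> \<open>In top dimension the left side is 1 and the correction term is 0, so it
      suffices to count \<open>P\<close> itself.\<close>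
    then have "P \<in> ?A P" using Suc.prems by (simp add: face_of_refl polytope_imp_convex)
    then have "face_number k P \<noteq> 0" using finA by (auto simp: face_number_def)
    with True show ?thesis by (simp add: binomial_eq_0)
  next
    case False
    have finV: "finite ?V"
      using Suc.prems(1) finite_polyhedron_extreme_points polytope_imp_polyhedron by blast
    obtain F where F: "F facet_of P" "s = 1 \<or> 2 \<le> card (?V - F)"
    proof (cases "s = 1")
      case True
      obtain F where "F facet_of P" using polytope_facet_exists[of P] Suc.prems by auto
      then show ?thesis using that True by blast
    next
      case False
      then have "card ?V > Suc d + 1" using Suc.prems by simp
      then show ?thesis using facet_missing_two_vertices[of P "Suc d"] Suc.prems that by blast
    qed
    define m where "m = card (?V - F)"
    have face: "F face_of P" using F facet_of_imp_face_of by blast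
    have polyF: "polytope F" using Suc.prems(1) face by (rule face_of_polytope_polytope)
    have dimF: "aff_dim F = int d" using F Suc.prems by (simp add: facet_of_def)
    have VF: "{v. v extreme_point_of F} = ?V \<inter> F"
      using extreme_point_of_face[OF face] by blast
    have "card (?V - F) + card (?V \<inter> F) = card ?V"
      using card_Int_Diff finV by (metis add.commute)
    then have cardF: "m + card {v. v extreme_point_of F} = Suc d + s"
      using Suc.prems VF by (simp add: m_def)
    \<comment> \<open>The facet keeps at least \<open>d + 1\<close> of the \<open>Suc d + s\<close>
      vertices, hence misses at most \<open>s\<close>.\<close>
    moreover have "d < card {v. v extreme_point_of F}"
      using card_vertices_polytope_gt_aff_dim[OF polyF] dimF by simp
    ultimately have "m \<le> s" by simp
    have "m \<noteq> 0"
    proof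
      assume "m = 0"
      then have "?V \<subseteq> F" using finV by (simp add: m_def)
      then have "convex hull ?V \<subseteq> F"
        using polyF polytope_imp_convex by (intro hull_minimal) auto
      moreover have "P = convex hull ?V"
        using Suc.prems(1) by (intro Krein_Milman_Minkowski polytope_imp_compact polytope_imp_convex)
      ultimately have "P \<subseteq> F" by simp
      then show False using aff_dim_subset[of P F] dimF Suc.prems by simp
    qed
    have m: "s = 1 \<and> m = 1 \<or> 2 \<le> m" using F(2) \<open>m \<le> s\<close> \<open>m \<noteq> 0\<close> by (auto simp: m_def)
    \<comment> \<open>The facet has \<open>d + (s + 1 - m)\<close> vertices. The excess
      \<open>s + 1 - m\<close> is at least 1 because \<open>m \<le> s\<close>, and at most
      \<open>d\<close> because either \<open>m \<ge> 2\<close> or \<open>s = m = 1\<close>.\<close>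
    have IH: "((d + 1) choose (k + 1)) + (d choose (k + 1))
        \<le> face_number k F + ((d + 1 - (s + 1 - m)) choose (k + 1))"
      using polyF dimF cardF m \<open>m \<le> s\<close> Suc.prems False by (intro Suc.IH) auto
    let ?B = "{H. H face_of P \<and> H \<inter> (?V - F) \<noteq> {} \<and> aff_dim H = int k}"
    have "(\<Sum>i<m. (Suc d - i) choose k) \<le> card ?B"
      unfolding m_def using Suc.prems finV \<open>m \<le> s\<close>
      by (intro card_faces_meeting_vertices_ge) (auto simp: m_def)
    then have B: "(Suc d + 1) choose (k + 1) \<le> card ?B + ((Suc d + 1 - m) choose (k + 1))"
      using sum_choose_descending[of m "Suc d" k] \<open>m \<le> s\<close> Suc.prems by linarith
    have "face_number k F + card ?B = card (?A F \<union> ?B)"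
      unfolding face_number_def
    proof (rule card_Un_disjoint[symmetric])
      show "finite (?A F)" by (rule finite_subset[OF _ finA]) (use face face_of_trans in auto)
      show "finite ?B" by (rule finite_subset[OF _ finA]) auto
      show "?A F \<inter> ?B = {}" using face_of_imp_subset by blast
    qed
    also have "\<dots> \<le> face_number k P"
      unfolding face_number_def using face by (intro card_mono finA) (auto intro: face_of_trans)
    finally have total: "face_number k F + card ?B \<le> face_number k P" .
    \<comment> \<open>These are the correction terms left after adding \<open>IH\<close> and
      \<open>B\<close>. The upper indices on both sides have the same sum, and for
      \<open>2 \<le> m\<close> those on the left lie between those on the right, so convexity
      applies. For \<open>s = m = 1\<close> the two sides agree.\<close>
    have conv: "((d + 1 - (s + 1 - m)) choose (k + 1)) + ((Suc d + 1 - m) choose (k + 1))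
        \<le> (d choose (k + 1)) + ((Suc d + 1 - s) choose (k + 1))"
    proof (cases "2 \<le> m")
      case True
      define b where "b = Suc d + 1 - s"
      have eqs: "b + (m - 2) = d + 1 - (s + 1 - m)" "b + (s - m) = Suc d + 1 - m"
        "b + (m - 2) + (s - m) = d"
        using True \<open>m \<le> s\<close> Suc.prems by (auto simp: b_def)
      show ?thesis
        using choose_convex[of b "m - 2" "k + 1" "s - m"]
        \<comment> \<open>The third equation goes first because its left side contains that of the
          first.\<close>
        unfolding eqs(3) unfolding eqs(1,2) unfolding b_def .
    next
      case False
      with m show ?thesis by simp
    qed
    show ?thesis using IH B total conv by simp
  qed
qed

theorem theorem3p2:
  fixes P :: "'a::euclidean_space set" and d s k :: nat
  assumes "s \<ge> 3" and "d \<ge> s"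
    and "polytope P" and "aff_dim P = int d"
    and "card {v. v extreme_point_of P} = d + s"
    and "1 \<le> k" and "k \<le> d - 1"
  shows "int (face_number k P) \<ge> phi k (d + s) d"
proof -
  have "((d + 1) choose (k + 1)) + (d choose (k + 1))
      \<le> face_number k P + ((d + 1 - s) choose (k + 1))"
    using assms by (intro face_number_lower_bound) auto
  then show ?thesis by (simp add: phi_def)
qed

end
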